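(* Let $K\ge 1$ be an integer, let $w_i\in\mathbb{R}^d$, let $B_0,\dots,B_{K-1},B_K$ be minibatches, and for each $k\in\{0,\dots,K\}$ let $\varphi\mapsto L(\varphi,B_k)$ be a real-valued loss on $\mathbb{R}^d$ that is three times differentiable at $w_i$. For an inner-loop learning rate $\lambda_{\mathrm{in}}>0$ define $\varphi_0=w_i$ and $$\varphi_{k+1}=\varphi_k-\lambda_{\mathrm{in}}\nabla_{\varphi_k}L(\varphi_k,B_k),\qquad k=0,\dots,K-1.$$ Let $g_M=\nabla_{w_i}L(\varphi_K,B_K)$ (the gradient of $w_i\mapsto L(\varphi_K(w_i),B_K)$) and $g_k=\nabla_{\varphi_0}L(\varphi_0,B_k)$ for $k=0,\dots,K$. Then the first-order approximation (in $\lambda_{\mathrm{in}}$) of the meta-gradient $g_M$ is $$g_M\approx g_K-\lambda_{\mathrm{in}}\,\mathcal{I}_K,\qquad \mathcal{I}_K=\sum_{k=0}^{K-1}\nabla_{\varphi_0}\langle g_K,g_k\rangle ,$$ that is, $g_M=g_K-\lambda_{\mathrm{in}}\,\mathcal{I}_K+O(\lambda_{\mathrm{in}}^2)$ as $\lambda_{\mathrm{in}}\to 0$, with $w_i$, $K$ and the minibatches fixed.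
   Context: Setting: local meta-optimization at one outer step $i$. $w_i$ is the local meta-learner's parameter vector. The neural field parameters $\varphi$ are initialized at $\varphi_0=w_i$ and updated by $K$ gradient steps (inner loop) on minibatches $B_0,\dots,B_{K-1}$ sampled from the support set; $B_K$ is a minibatch of the query set. $L(\varphi,B)$ denotes the loss of parameter $\varphi$ on the minibatch $B$. The gradient $\nabla_{w_i}L(\varphi_K,B_K)$ is taken through the whole inner loop, with $\varphi_K$ regarded as a function of $w_i$. In $\nabla_{\varphi_0}\langle g_K,g_k\rangle$, both $g_K$ and $g_k$ are regarded as functions of $\varphi_0$, namely $\varphi_0\mapsto\nabla L(\varphi_0,B_K)$ and $\varphi_0\mapsto\nabla L(\varphi_0,B_k)$; $\langle\cdot,\cdot\rangle$ is the Euclidean inner product. The symbol $\approx$ means equality up to terms of second order in the learning rate. *)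

theory Defs
  imports "HOL-Analysis.Analysis" "HOL-Library.Landau_Symbols"
begin

text \<open>Unspecified where \<open>f\<close> is not differentiable; otherwise it is the vector representing the
  Frechet derivative, see \<open>GDERIV_grad\<close> and \<open>grad_eqI\<close> below.\<close>

definition grad :: "('a::euclidean_space \<Rightarrow> real) \<Rightarrow> 'a \<Rightarrow> 'a" where
  "grad f x = (THE D. GDERIV f x :> D)"

lemma grad_eqI:
  assumes "GDERIV f x :> D"
  shows "grad f x = D"
  unfolding grad_def
proof (rule the_equality)
  show "GDERIV f x :> D" by (rule assms)
next
  fix D' assume "GDERIV f x :> D'"
  then have "(\<lambda>h. h \<bullet> D') = (\<lambda>h. h \<bullet> D)"
    using assms has_derivative_unique unfolding gderiv_def by blast
  then show "D' = D"
    by (metis vector_eq_ldot)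
qed

lemma GDERIV_grad:
  assumes "f differentiable at x"
  shows "GDERIV f x :> grad f x"
proof -
  obtain f' where f': "(f has_derivative f') (at x)"
    using assms unfolding differentiable_def by blast
  define D where "D = (\<Sum>b\<in>Basis. f' b *\<^sub>R b)"
  have lin: "linear f'"
    using f' has_derivative_linear by blast
  have "f' h = h \<bullet> D" for h
  proof -
    have "f' h = f' (\<Sum>b\<in>Basis. (h \<bullet> b) *\<^sub>R b)"
      by (simp add: euclidean_representation)
    also have "\<dots> = (\<Sum>b\<in>Basis. (h \<bullet> b) * f' b)"
      using lin by (simp add: linear_sum linear_scale)
    also have "\<dots> = h \<bullet> D"
      unfolding D_def by (simp add: inner_sum_right mult.commute)
    finally show ?thesis .
  qed
  then have "f' = (\<lambda>h. h \<bullet> D)" by blast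
  then have "GDERIV f x :> D"
    using f' unfolding gderiv_def by simp
  then show ?thesis
    using grad_eqI by metis
qed

text \<open>Frechet differentiability of order three at a point: the first and the second derivative exist
  on a neighbourhood of \<open>x\<close>, the third one need only exist at \<open>x\<close>.\<close>

definition three_times_differentiable_at ::
    "('a::real_normed_vector \<Rightarrow> 'b::real_normed_vector) \<Rightarrow> 'a \<Rightarrow> bool" where
  "three_times_differentiable_at f x \<longleftrightarrow>
     (\<exists>(f' :: 'a \<Rightarrow> 'a \<Rightarrow>\<^sub>L 'b) (f'' :: 'a \<Rightarrow> 'a \<Rightarrow>\<^sub>L 'a \<Rightarrow>\<^sub>L 'b).
        (\<forall>\<^sub>F y in nhds x. (f has_derivative blinfun_apply (f' y)) (at y)) \<and>
        (\<forall>\<^sub>F y in nhds x. (f' has_derivative blinfun_apply (f'' y)) (at y)) \<and>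
        f'' differentiable (at x))"

text \<open>\<open>inner_loop L B l w k\<close> is the parameter after \<open>k\<close> gradient steps with learning rate \<open>l\<close>
  from \<open>w\<close>; step number \<open>k\<close> uses the minibatch \<open>B k\<close>. The type \<open>'b\<close> of minibatches is arbitrary.\<close>

primrec inner_loop ::
    "('a::euclidean_space \<Rightarrow> 'b \<Rightarrow> real) \<Rightarrow> (nat \<Rightarrow> 'b) \<Rightarrow> real \<Rightarrow> 'a \<Rightarrow> nat \<Rightarrow> 'a" where
  "inner_loop L B l w 0 = w"
| "inner_loop L B l w (Suc k) =
     inner_loop L B l w k - l *\<^sub>R grad (\<lambda>\<phi>. L \<phi> (B k)) (inner_loop L B l w k)"

definition meta_loss ::
    "('a::euclidean_space \<Rightarrow> 'b \<Rightarrow> real) \<Rightarrow> (nat \<Rightarrow> 'b) \<Rightarrow> nat \<Rightarrow> real \<Rightarrow> 'a \<Rightarrow> real" where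
  "meta_loss L B K l w = L (inner_loop L B l w K) (B K)"

definition meta_gradient ::
    "('a::euclidean_space \<Rightarrow> 'b \<Rightarrow> real) \<Rightarrow> (nat \<Rightarrow> 'b) \<Rightarrow> nat \<Rightarrow> real \<Rightarrow> 'a \<Rightarrow> 'a" where
  "meta_gradient L B K l w = grad (meta_loss L B K l) w"

definition batch_gradient ::
    "('a::euclidean_space \<Rightarrow> 'b \<Rightarrow> real) \<Rightarrow> (nat \<Rightarrow> 'b) \<Rightarrow> nat \<Rightarrow> 'a \<Rightarrow> 'a" where
  "batch_gradient L B k \<phi> = grad (\<lambda>\<psi>. L \<psi> (B k)) \<phi>"

definition gradient_alignment ::
    "('a::euclidean_space \<Rightarrow> 'b \<Rightarrow> real) \<Rightarrow> (nat \<Rightarrow> 'b) \<Rightarrow> nat \<Rightarrow> 'a \<Rightarrow> 'a" where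
  "gradient_alignment L B K w =
     (\<Sum>k<K. grad (\<lambda>\<phi>. batch_gradient L B K \<phi> \<bullet> batch_gradient L B k \<phi>) w)"

end

(* The inner loop displaces the parameter by
   phi_K - w = - l * (g_0 + ... + g_{K-1}) + O(l^2), and its Jacobian in w is
   I - l * (H_0 + ... + H_{K-1}) + O(l^2), where H_k is the Hessian of the k-th loss at w.
   Inserting both in the chain rule, the coefficient of -l in the meta-gradient is the sum of
   H_K g_k + H_k^T g_K, whereas the gradient of the inner product of g_K and g_k is
   H_K^T g_k + H_k^T g_K. The two agree because Hessians are symmetric. *)

theory Submission
  imports Defs
begin

text \<open>Two obstacles shape the argument. An \<open>O(l^2)\<close> bound at the fixed start
  \<open>w\<close> cannot be differentiated in \<open>w\<close>, so the derivative of the inner loop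
  in its start is computed exactly for each small \<open>l\<close>, by a recursion
  (\<open>jacobian\<close>), and only afterwards expanded in \<open>l\<close>. Moreover, the
  derivatives of the losses are available only near \<open>w\<close>, so facts about the iterates
  hold only eventually as \<open>l\<close> tends to 0 from above.

  In the recursions for the iterates and for the Jacobian every new term carries a factor
  \<open>l\<close>, so gradients and Hessians along the loop are needed only up to
  \<open>O(l)\<close>. Differentiability at \<open>w\<close> provides this; for the Hessians it is
  the third derivative. The third derivative also makes the Taylor remainder of g_K at phi_K
  quadratic.\<close>

lemma blinfun_compose_id_right: "T o\<^sub>L id_blinfun = T"
  by (rule blinfun_eqI) simp

section \<open>Symmetry of the second derivative at a point\<close>

text \<open>The mean value theorem in the direction \<open>v\<close> only uses the expansion of \<open>f'\<close> at \<open>x\<close>, so the second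
  derivative need not be continuous.\<close>

lemma second_difference_bound:
  fixes f :: "'a::real_normed_vector \<Rightarrow> real" and f' :: "'a \<Rightarrow> 'a \<Rightarrow>\<^sub>L real"
    and f'' :: "'a \<Rightarrow>\<^sub>L 'a \<Rightarrow>\<^sub>L real"
  assumes f': "\<forall>\<^sub>F y in nhds x. (f has_derivative blinfun_apply (f' y)) (at y)"
    and f'': "(f' has_derivative blinfun_apply f'') (at x)"
    and e: "e > 0"
  shows "\<forall>\<^sub>F t in at_right 0.
    \<bar>f (x + t *\<^sub>R u + t *\<^sub>R v) - f (x + t *\<^sub>R u) - f (x + t *\<^sub>R v) + f x - t\<^sup>2 * f'' u v\<bar> \<le> e * t\<^sup>2"
proof -
  define M where "M = norm u + norm v + 1"
  have M: "M > 0" "norm u + norm v \<le> M" "norm v \<le> M"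
    unfolding M_def by (auto intro: add_nonneg_pos)
  \<comment> \<open>Two remainders will be added, each at most \<open>e' * (t * M) * M\<close>: the
    displacement is at most \<open>t * M\<close> and the direction \<open>v\<close> has norm at most
    \<open>M\<close>. This choice makes their sum \<open>e * t\<close>.\<close>
  define e' where "e' = e / (2 * M * M)"
  have e': "e' > 0"
    using e M by (simp add: e'_def)
  obtain d1 where d1: "d1 > 0" "\<And>y. dist y x < d1 \<Longrightarrow> (f has_derivative blinfun_apply (f' y)) (at y)"
    using f' unfolding eventually_nhds_metric by blast
  obtain d2 where d2: "d2 > 0"
    "\<And>y. norm (y - x) < d2 \<Longrightarrow> norm (f' y - f' x - f'' (y - x)) \<le> e' * norm (y - x)"
    using f'' e' unfolding has_derivative_at_alt by blast
  define d where "d = min d1 d2 / M"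
  have "d > 0"
    using d1 d2 M by (simp add: d_def)
  moreover have "\<bar>f (x + t *\<^sub>R u + t *\<^sub>R v) - f (x + t *\<^sub>R u) - f (x + t *\<^sub>R v) + f x - t\<^sup>2 * f'' u v\<bar> \<le> e * t\<^sup>2"
    if t: "0 < t" "t < d" for t
  proof -
    have tM: "t * M < d1" "t * M < d2"
      using t M by (auto simp: d_def field_simps)
    have near: "norm (r *\<^sub>R u + s *\<^sub>R v) \<le> t * M" if "0 \<le> r" "r \<le> t" "0 \<le> s" "s \<le> t" for r s
    proof -
      have "norm (r *\<^sub>R u + s *\<^sub>R v) \<le> r * norm u + s * norm v"
        using that by (metis abs_of_nonneg norm_scaleR norm_triangle_ineq)
      also have "\<dots> \<le> t * norm u + t * norm v"
        using that by (intro add_mono mult_right_mono) auto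
      also have "\<dots> \<le> t * M"
        using M t by (simp add: distrib_left[symmetric])
      finally show ?thesis .
    qed
    have D: "(f has_derivative blinfun_apply (f' (x + (r *\<^sub>R u + s *\<^sub>R v)))) (at (x + (r *\<^sub>R u + s *\<^sub>R v)))"
      if "0 \<le> r" "r \<le> t" "0 \<le> s" "s \<le> t" for r s
      using near[OF that] tM by (intro d1) (simp add: dist_norm)
    have R: "\<bar>f' (x + (r *\<^sub>R u + s *\<^sub>R v)) v - f' x v - (r * f'' u v + s * f'' v v)\<bar> \<le> e' * (t * M) * M"
      if "0 \<le> r" "r \<le> t" "0 \<le> s" "s \<le> t" for r s
    proof -
      define y where "y = r *\<^sub>R u + s *\<^sub>R v"
      have "norm (f' (x + y) - f' x - f'' y) \<le> e' * norm y"
        using d2(2)[of "x + y"] near[OF that] tM by (simp add: y_def)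
      also have "\<dots> \<le> e' * (t * M)"
        using near[OF that] e' by (simp add: y_def)
      finally have "norm ((f' (x + y) - f' x - f'' y) v) \<le> e' * (t * M) * M"
        using M e' t by (intro order_trans[OF norm_blinfun]) (auto intro!: mult_mono)
      then show ?thesis
        by (simp add: y_def blinfun.bilinear_simps)
    qed
    \<comment> \<open>\<open>G t - G 0\<close> is the second difference. The vacuous
      \<open>0 *\<^sub>R u\<close> gives both base points the shape that \<open>R\<close> expects,
      with \<open>r = t\<close> and \<open>r = 0\<close>.\<close>
    define G where "G s = f (x + (t *\<^sub>R u + s *\<^sub>R v)) - f (x + (0 *\<^sub>R u + s *\<^sub>R v))" for s
    define G' where "G' s = f' (x + (t *\<^sub>R u + s *\<^sub>R v)) v - f' (x + (0 *\<^sub>R u + s *\<^sub>R v)) v" for s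
    have G: "(G has_real_derivative G' s) (at s)" if s: "0 \<le> s" "s \<le> t" for s
    proof -
      have A: "((\<lambda>s. f (x + (r *\<^sub>R u + s *\<^sub>R v))) has_derivative (\<lambda>h. f' (x + (r *\<^sub>R u + s *\<^sub>R v)) (h *\<^sub>R v))) (at s)"
        if "0 \<le> r" "r \<le> t" for r
      proof (rule has_derivative_compose[where g = f and f = "\<lambda>s. x + (r *\<^sub>R u + s *\<^sub>R v)"])
        show "((\<lambda>s. x + (r *\<^sub>R u + s *\<^sub>R v)) has_derivative (\<lambda>h. h *\<^sub>R v)) (at s)"
          by (auto intro!: derivative_eq_intros)
      qed (rule D[OF that s])
      have "(G has_derivative (\<lambda>h. f' (x + (t *\<^sub>R u + s *\<^sub>R v)) (h *\<^sub>R v) - f' (x + (0 *\<^sub>R u + s *\<^sub>R v)) (h *\<^sub>R v))) (at s)"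
        unfolding G_def using t by (intro has_derivative_diff A) auto
      then show ?thesis
        unfolding has_field_derivative_def G'_def
        by (rule has_derivative_eq_rhs) (simp add: blinfun.bilinear_simps fun_eq_iff algebra_simps)
    qed
    obtain s where s: "0 < s" "s < t" "G t - G 0 = (t - 0) * G' s"
      using MVT2[of 0 t G G'] t G by auto
    \<comment> \<open>Subtracting the two expansions cancels \<open>f' x v\<close> and
      \<open>s * f'' v v\<close>, so the unknown intermediate point \<open>s\<close> drops out of
      the main term.\<close>
    have "\<bar>G' s - t * f'' u v\<bar> \<le> 2 * (e' * (t * M) * M)"
      using R[of t s] R[of 0 s] s t unfolding G'_def by linarith
    also have "\<dots> = e * t"
      using M by (simp add: e'_def field_simps)
    finally have "t * \<bar>G' s - t * f'' u v\<bar> \<le> t * (e * t)"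
      using t by simp
    moreover have "t * \<bar>G' s - t * f'' u v\<bar> = \<bar>G t - G 0 - t\<^sup>2 * f'' u v\<bar>"
      using t s by (simp add: abs_mult_pos' power2_eq_square right_diff_distrib mult.assoc)
    moreover have "G t - G 0 = f (x + t *\<^sub>R u + t *\<^sub>R v) - f (x + t *\<^sub>R u) - f (x + t *\<^sub>R v) + f x"
      by (simp add: G_def add.assoc)
    ultimately show ?thesis
      by (simp add: power2_eq_square mult_ac)
  qed
  ultimately show ?thesis
    unfolding eventually_at_right_field by (auto intro!: exI[of _ d])
qed

text \<open>The second difference is symmetric in \<open>u\<close> and \<open>v\<close>, and it
  approximates both \<open>t\<^sup>2 * f'' u v\<close> and \<open>t\<^sup>2 * f'' v u\<close> within
  \<open>e * t\<^sup>2\<close>. Dividing by \<open>t\<^sup>2\<close> leaves an arbitrarily small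
  bound.\<close>

lemma second_derivative_symmetric:
  fixes f :: "'a::real_normed_vector \<Rightarrow> real" and f' :: "'a \<Rightarrow> 'a \<Rightarrow>\<^sub>L real"
    and f'' :: "'a \<Rightarrow>\<^sub>L 'a \<Rightarrow>\<^sub>L real"
  assumes f': "\<forall>\<^sub>F y in nhds x. (f has_derivative blinfun_apply (f' y)) (at y)"
    and f'': "(f' has_derivative blinfun_apply f'') (at x)"
  shows "f'' u v = f'' v u"
proof -
  have "\<bar>f'' u v - f'' v u\<bar> \<le> 2 * e" if "e > 0" for e
  proof -
    have "\<forall>\<^sub>F t in at_right 0. t > (0::real) \<and> \<bar>f'' u v - f'' v u\<bar> \<le> 2 * e"
      using second_difference_bound[OF f' f'' that, of u v]
        second_difference_bound[OF f' f'' that, of v u] eventually_at_right_less[of "0::real"]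
    proof eventually_elim
      case (elim t)
      have "f (x + t *\<^sub>R v + t *\<^sub>R u) = f (x + t *\<^sub>R u + t *\<^sub>R v)"
        by (simp add: algebra_simps)
      then have "\<bar>t\<^sup>2 * f'' u v - t\<^sup>2 * f'' v u\<bar> \<le> 2 * e * t\<^sup>2"
        using elim by linarith
      moreover have "\<bar>t\<^sup>2 * f'' u v - t\<^sup>2 * f'' v u\<bar> = t\<^sup>2 * \<bar>f'' u v - f'' v u\<bar>"
        by (simp add: right_diff_distrib[symmetric] abs_mult)
      ultimately have "t\<^sup>2 * \<bar>f'' u v - f'' v u\<bar> \<le> t\<^sup>2 * (2 * e)"
        by (simp add: mult_ac)
      then show ?case
        using elim by simp
    qed
    then show ?thesis
      using eventually_happens trivial_limit_at_right_real by blast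
  qed
  then have "\<bar>f'' u v - f'' v u\<bar> \<le> 0 + e" if "e > 0" for e
    using that[THEN half_gt_zero] by fastforce
  then have "\<bar>f'' u v - f'' v u\<bar> \<le> 0"
    by (rule field_le_epsilon)
  then show ?thesis by simp
qed

section \<open>Orders of vanishing in the learning rate\<close>

text \<open>Taking norms first puts parameters, gradients and operators under one real Landau class.
  The filter is one-sided because learning rates are positive.\<close>

definition vanishes_to_order :: "nat \<Rightarrow> (real \<Rightarrow> 'a::real_normed_vector) \<Rightarrow> bool" where
  "vanishes_to_order n f \<longleftrightarrow> (\<lambda>l. norm (f l)) \<in> O[at_right 0](\<lambda>l. l ^ n)"

lemma vanishes_to_orderI:
  assumes "\<forall>\<^sub>F l in at_right 0. norm (f l) \<le> C * norm (h l)"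
    and "vanishes_to_order n h"
  shows "vanishes_to_order n f"
  unfolding vanishes_to_order_def
proof (rule landau_o.big_trans)
  show "(\<lambda>l. norm (f l)) \<in> O[at_right 0](\<lambda>l. norm (h l))"
    using assms(1) by (intro bigoI[where c = C]) simp
  show "(\<lambda>l. norm (h l)) \<in> O[at_right 0](\<lambda>l. l ^ n)"
    using assms(2) by (simp add: vanishes_to_order_def)
qed

lemma vanishes_to_order_power: "vanishes_to_order n (\<lambda>l. l ^ n)"
  by (simp add: vanishes_to_order_def)

lemma vanishes_to_order_0: "vanishes_to_order n (\<lambda>l. 0)"
  by (simp add: vanishes_to_order_def)

lemma vanishes_to_order_add:
  assumes "vanishes_to_order n f" "vanishes_to_order n h"
  shows "vanishes_to_order n (\<lambda>l. f l + h l)"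
proof -
  have "(\<lambda>l. norm (f l) + norm (h l)) \<in> O[at_right 0](\<lambda>l. l ^ n)"
    using assms unfolding vanishes_to_order_def by (rule sum_in_bigo)
  then have "vanishes_to_order n (\<lambda>l. norm (f l) + norm (h l))"
    by (simp add: vanishes_to_order_def)
  then show ?thesis
    by (rule vanishes_to_orderI[rotated, where C = 1]) (simp add: norm_triangle_ineq)
qed

text \<open>One product rule serves both scaling by \<open>l\<close> and the composition of
  operators.\<close>

lemma vanishes_to_order_bilinear:
  assumes "bounded_bilinear P" "vanishes_to_order m f" "vanishes_to_order n h"
  shows "vanishes_to_order (m + n) (\<lambda>l. P (f l) (h l))"
proof -
  obtain C where C: "\<And>a b. norm (P a b) \<le> norm a * norm b * C"
    using bounded_bilinear.bounded[OF assms(1)] by blast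
  have "(\<lambda>l. norm (f l) * norm (h l)) \<in> O[at_right 0](\<lambda>l. l ^ (m + n))"
    using assms unfolding vanishes_to_order_def power_add by (intro landau_o.big.mult)
  then have "vanishes_to_order (m + n) (\<lambda>l. norm (f l) * norm (h l))"
    by (simp add: vanishes_to_order_def abs_mult)
  then show ?thesis
    by (rule vanishes_to_orderI[rotated, where C = C])
      (use C in \<open>simp add: mult.commute abs_mult\<close>)
qed

lemma vanishes_to_order_linear:
  assumes "bounded_linear T" "vanishes_to_order n f"
  shows "vanishes_to_order n (\<lambda>l. T (f l))"
proof -
  obtain C where "\<And>a. norm (T a) \<le> norm a * C"
    using bounded_linear.bounded[OF assms(1)] by blast
  then show ?thesis
    by (intro vanishes_to_orderI[OF _ assms(2), where C = C]) (simp add: mult.commute)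
qed

lemma vanishes_to_order_diff:
  assumes "vanishes_to_order n f" "vanishes_to_order n h"
  shows "vanishes_to_order n (\<lambda>l. f l - h l)"
  using vanishes_to_order_add[OF assms(1) vanishes_to_order_linear[OF _ assms(2), of uminus]]
  by (simp add: bounded_linear_minus[OF bounded_linear_ident])

lemma vanishes_to_order_const: "vanishes_to_order 0 (\<lambda>l. c)"
  by (simp add: vanishes_to_order_def)

lemma vanishes_to_order_scaleR:
  assumes "vanishes_to_order n f"
  shows "vanishes_to_order (Suc n) (\<lambda>l. l *\<^sub>R f l)"
  using vanishes_to_order_bilinear[OF bounded_bilinear_scaleR vanishes_to_order_power[of 1] assms]
  by simp

lemma vanishes_to_order_Suc:
  assumes "vanishes_to_order (Suc n) f"
  shows "vanishes_to_order n f"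
  unfolding vanishes_to_order_def
proof (rule landau_o.big_trans)
  show "(\<lambda>l. norm (f l)) \<in> O[at_right 0](\<lambda>l. l ^ Suc n)"
    using assms by (simp add: vanishes_to_order_def)
  have "\<forall>\<^sub>F l in at_right (0::real). l < 1"
    by (auto simp: eventually_at_right_field intro!: exI[of _ 1])
  then have "\<forall>\<^sub>F l in at_right 0. norm (l ^ Suc n :: real) \<le> 1 * norm (l ^ n)"
    using eventually_at_right_less[of "0::real"]
    by eventually_elim (simp add: abs_mult mult_left_le_one_le)
  then show "(\<lambda>l. l ^ Suc n) \<in> O[at_right 0](\<lambda>l::real. l ^ n)"
    by (rule bigoI)
qed

lemma vanishes_to_order_tendsto:
  assumes "vanishes_to_order 1 f"
  shows "(f \<longlongrightarrow> 0) (at_right 0)"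
proof -
  obtain C where C: "\<forall>\<^sub>F l in at_right 0. norm (f l) \<le> C * \<bar>l\<bar>"
    using assms unfolding vanishes_to_order_def bigo_def
    by (auto simp: abs_mult)
  have "((\<lambda>l. C * \<bar>l\<bar>) \<longlongrightarrow> C * \<bar>0\<bar>) (at_right 0)"
    by (intro tendsto_intros)
  then show ?thesis
    using Lim_null_comparison[OF C] by simp
qed

text \<open>Since \<open>p\<close> approaches \<open>w\<close> at rate \<open>l\<close>, an order in
  the distance to \<open>w\<close> becomes the same order in \<open>l\<close>.\<close>

lemma vanishes_to_order_compose:
  assumes R: "\<forall>\<^sub>F y in nhds w. norm (R y) \<le> C * norm (y - w) ^ n"
    and p: "vanishes_to_order 1 (\<lambda>l. p l - w)"
  shows "vanishes_to_order n (\<lambda>l. R (p l))"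
proof (rule vanishes_to_orderI)
  have "(p \<longlongrightarrow> w) (at_right 0)"
    using vanishes_to_order_tendsto[OF p] by (rule LIM_zero_cancel)
  then show "\<forall>\<^sub>F l in at_right 0. norm (R (p l)) \<le> C * norm (norm (p l - w) ^ n)"
    using eventually_compose_filterlim[OF R] by (simp add: norm_power)
  have "(\<lambda>l. norm (p l - w) ^ n) \<in> O[at_right 0](\<lambda>l. (l ^ 1) ^ n)"
    using p unfolding vanishes_to_order_def by (rule landau_o.big_power)
  then show "vanishes_to_order n (\<lambda>l. norm (p l - w) ^ n)"
    by (simp add: vanishes_to_order_def norm_power)
qed

section \<open>Remainder bounds centred at one point\<close>

text \<open>Differentiability at one point gives a Lipschitz estimate with that point as fixed
  centre. This is what the Hessians, differentiable at \<open>w\<close>, can offer.\<close>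

lemma differentiable_at_linear_bound:
  assumes "F differentiable (at w)"
  obtains C where "\<forall>\<^sub>F y in nhds w. norm (F y - F w) \<le> C * norm (y - w)"
proof -
  obtain F' where F': "(F has_derivative F') (at w)"
    using assms by (auto simp: differentiable_def)
  then have "bounded_linear F'" by (rule has_derivative_bounded_linear)
  then obtain C where C: "\<And>h. norm (F' h) \<le> norm h * C"
    using bounded_linear.bounded by blast
  obtain d where d: "d > 0"
    "\<And>y. norm (y - w) < d \<Longrightarrow> norm (F y - F w - F' (y - w)) \<le> 1 * norm (y - w)"
    using F' unfolding has_derivative_at_alt by (metis zero_less_one)
  have "norm (F y - F w) \<le> (1 + C) * norm (y - w)" if "dist y w < d" for y
  proof -
    have "norm (F y - F w) \<le> norm (F y - F w - F' (y - w)) + norm (F' (y - w))"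
      by (metis diff_add_cancel norm_triangle_ineq)
    also have "\<dots> \<le> (1 + C) * norm (y - w)"
      using d(2)[of y] C[of "y - w"] that by (simp add: dist_norm algebra_simps)
    finally show ?thesis .
  qed
  then show ?thesis
    using d(1) by (intro that[of "1 + C"]) (auto simp: eventually_nhds_metric)
qed

text \<open>The mean value inequality is applied to \<open>F\<close> minus its linear part
  \<open>F' w\<close>. The derivative of this difference at \<open>z\<close> is
  \<open>F' z - F' w\<close>, which is linearly small by the estimate centred at \<open>w\<close>;
  continuity of a second derivative does not enter.\<close>

lemma second_order_remainder_bound:
  fixes F' :: "'a::real_normed_vector \<Rightarrow> 'a \<Rightarrow>\<^sub>L 'b::real_normed_vector"
  assumes F: "\<forall>\<^sub>F y in nhds w. (F has_derivative blinfun_apply (F' y)) (at y)"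
    and F': "F' differentiable (at w)"
  obtains C where "\<forall>\<^sub>F y in nhds w. norm (F y - F w - F' w (y - w)) \<le> C * norm (y - w) ^ 2"
proof -
  obtain C where C: "\<forall>\<^sub>F y in nhds w. norm (F' y - F' w) \<le> C * norm (y - w)"
    using differentiable_at_linear_bound[OF F'] .
  obtain d where d: "d > 0"
    "\<And>y. dist y w < d \<Longrightarrow> (F has_derivative blinfun_apply (F' y)) (at y)
      \<and> norm (F' y - F' w) \<le> C * norm (y - w)"
    using eventually_conj[OF F C] unfolding eventually_nhds_metric by blast
  have "norm (F y - F w - F' w (y - w)) \<le> \<bar>C\<bar> * norm (y - w) ^ 2" if y: "dist y w < d" for y
  proof -
    \<comment> \<open>A convex set containing \<open>w\<close> and \<open>y\<close> on which no
      point is farther from \<open>w\<close> than \<open>y\<close>.\<close>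
    define S where "S = cball w (dist w y)"
    have S: "dist z w < d" "norm (z - w) \<le> norm (y - w)" if "z \<in> S" for z
      using that y by (simp_all add: S_def dist_norm[symmetric] dist_commute)
    have "norm ((F y - F' w y) - (F w - F' w w)) \<le> (\<bar>C\<bar> * norm (y - w)) * norm (y - w)"
    proof (rule differentiable_bound[where S = S
          and f = "\<lambda>z. F z - F' w z" and f' = "\<lambda>z h. F' z h - F' w h"])
      show "((\<lambda>z. F z - F' w z) has_derivative (\<lambda>h. F' z h - F' w h)) (at z within S)"
        if "z \<in> S" for z
        by (rule has_derivative_at_withinI, intro has_derivative_diff
          bounded_linear_imp_has_derivative blinfun.bounded_linear_right) (use d(2)[OF S(1)[OF that]] in simp)
      show "onorm (\<lambda>h. F' z h - F' w h) \<le> \<bar>C\<bar> * norm (y - w)" if "z \<in> S" for z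
      proof -
        have "norm (F' z - F' w) \<le> C * norm (z - w)"
          using d(2)[OF S(1)[OF that]] by simp
        also have "\<dots> \<le> \<bar>C\<bar> * norm (y - w)"
          using S(2)[OF that] by (intro mult_mono) auto
        finally show ?thesis
          by (simp add: norm_blinfun.rep_eq minus_blinfun.rep_eq)
      qed
    qed (simp_all add: S_def)
    then show ?thesis
      by (simp add: blinfun.diff_right power2_eq_square algebra_simps)
  qed
  then show ?thesis
    using d(1) by (intro that[of "\<bar>C\<bar>"]) (auto simp: eventually_nhds_metric)
qed

section \<open>Calculus of first-order expansions\<close>

text \<open>\<open>(a, b)\<close> is a one-sided 1-jet at 0. The remainder is \<open>O(l^2)\<close>
  rather than \<open>o(l)\<close>, as the final estimate demands.\<close>

definition first_order_expansion :: "(real \<Rightarrow> 'a::real_normed_vector) \<Rightarrow> 'a \<Rightarrow> 'a \<Rightarrow> bool" where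
  "first_order_expansion f a b \<longleftrightarrow> vanishes_to_order 2 (\<lambda>l. f l - (a + l *\<^sub>R b))"

lemma first_order_expansion_const: "first_order_expansion (\<lambda>l. a) a 0"
  by (simp add: first_order_expansion_def vanishes_to_order_0)

lemma first_order_expansion_imp_vanishes:
  assumes "first_order_expansion f a b"
  shows "vanishes_to_order 1 (\<lambda>l. f l - a)"
proof -
  have "vanishes_to_order 1 (\<lambda>l. f l - (a + l *\<^sub>R b))"
    using assms by (simp add: first_order_expansion_def vanishes_to_order_Suc numeral_2_eq_2)
  moreover have "vanishes_to_order 1 (\<lambda>l. l *\<^sub>R b)"
    using vanishes_to_order_scaleR[OF vanishes_to_order_const[of b]] by simp
  ultimately show ?thesis
    using vanishes_to_order_add by (fastforce simp: algebra_simps)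
qed

lemma first_order_expansion_diff:
  assumes "first_order_expansion f a b" "first_order_expansion h c d"
  shows "first_order_expansion (\<lambda>l. f l - h l) (a - c) (b - d)"
  using vanishes_to_order_diff[OF assms[unfolded first_order_expansion_def]]
  by (simp add: first_order_expansion_def algebra_simps)

text \<open>The factor \<open>l\<close> raises the order by one, so the limit of \<open>f\<close>
  with an \<open>O(l)\<close> error suffices. This keeps the inductions over the inner loop
  short.\<close>

lemma first_order_expansion_scaleR:
  assumes "vanishes_to_order 1 (\<lambda>l. f l - a)"
  shows "first_order_expansion (\<lambda>l. l *\<^sub>R f l) 0 a"
  using vanishes_to_order_scaleR[OF assms]
  by (simp add: first_order_expansion_def scaleR_diff_right numeral_2_eq_2)

text \<open>The usual insertion of \<open>P (a l) (h l)\<close>. The reference functions may vary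
  with \<open>l\<close>, since the comparison is made with constants and with affine functions
  alike.\<close>

lemma vanishes_to_order_bilinear_diff:
  assumes P: "bounded_bilinear P"
    and f: "vanishes_to_order n (\<lambda>l. f l - a l)" and h: "vanishes_to_order n (\<lambda>l. h l - b l)"
    and a: "vanishes_to_order 0 a" and b: "vanishes_to_order 0 b" and n: "vanishes_to_order 0 h"
  shows "vanishes_to_order n (\<lambda>l. P (f l) (h l) - P (a l) (b l))"
proof -
  interpret bounded_bilinear P by (rule P)
  have "vanishes_to_order n (\<lambda>l. P (f l - a l) (h l) + P (a l) (h l - b l))"
    using vanishes_to_order_bilinear[OF P f n] vanishes_to_order_bilinear[OF P a h]
    by (intro vanishes_to_order_add) simp_all
  then show ?thesis
    by (simp add: diff_left diff_right)
qed

lemma vanishes_to_order_bounded: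
  assumes "vanishes_to_order 1 (\<lambda>l. f l - a)"
  shows "vanishes_to_order 0 f"
  using vanishes_to_order_add[OF vanishes_to_order_Suc[OF assms[unfolded One_nat_def]]
      vanishes_to_order_const[of a]] by simp

lemma vanishes_to_order_bilinear_limit:
  assumes "bounded_bilinear P"
    and "vanishes_to_order 1 (\<lambda>l. f l - a)" and "vanishes_to_order 1 (\<lambda>l. h l - b)"
  shows "vanishes_to_order 1 (\<lambda>l. P (f l) (h l) - P a b)"
  by (rule vanishes_to_order_bilinear_diff[OF assms vanishes_to_order_const vanishes_to_order_const
        vanishes_to_order_bounded[OF assms(3)]])

lemma first_order_expansion_bilinear:
  assumes P: "bounded_bilinear P"
    and f: "first_order_expansion f a a'" and h: "first_order_expansion h b b'"
  shows "first_order_expansion (\<lambda>l. P (f l) (h l)) (P a b) (P a b' + P a' b)"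
proof -
  interpret bounded_bilinear P by (rule P)
  have affine: "vanishes_to_order 0 (\<lambda>l. c + l *\<^sub>R c')" for c c' :: "'x::real_normed_vector"
    using vanishes_to_order_scaleR[OF vanishes_to_order_const[of c']]
    by (intro vanishes_to_order_add[OF vanishes_to_order_const] vanishes_to_order_Suc[of 0])
  have "vanishes_to_order 2 (\<lambda>l. P (f l) (h l) - P (a + l *\<^sub>R a') (b + l *\<^sub>R b'))"
    by (rule vanishes_to_order_bilinear_diff[OF P f[unfolded first_order_expansion_def]
          h[unfolded first_order_expansion_def] affine affine
          vanishes_to_order_bounded[OF first_order_expansion_imp_vanishes[OF h]]])
  \<comment> \<open>The only term of the product of the two affine parts that is of second
    order.\<close>
  moreover have "vanishes_to_order 2 (\<lambda>l. l *\<^sub>R l *\<^sub>R P a' b')"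
    using vanishes_to_order_scaleR[OF vanishes_to_order_scaleR[OF vanishes_to_order_const]]
    by (simp add: numeral_2_eq_2)
  ultimately have "vanishes_to_order 2
      (\<lambda>l. P (f l) (h l) - P (a + l *\<^sub>R a') (b + l *\<^sub>R b') + l *\<^sub>R l *\<^sub>R P a' b')"
    by (rule vanishes_to_order_add)
  then show ?thesis
    by (simp add: first_order_expansion_def add_left add_right scaleR_left scaleR_right algebra_simps)
qed

lemma vanishes_to_order_compose_differentiable:
  assumes "F differentiable (at w)" and p: "vanishes_to_order 1 (\<lambda>l. p l - w)"
  shows "vanishes_to_order 1 (\<lambda>l. F (p l) - F w)"
proof -
  obtain C where "\<forall>\<^sub>F y in nhds w. norm (F y - F w) \<le> C * norm (y - w) ^ 1"
    using differentiable_at_linear_bound[OF assms(1)] by auto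
  then show ?thesis
    by (rule vanishes_to_order_compose[OF _ p])
qed

lemma first_order_expansion_compose:
  assumes F: "\<forall>\<^sub>F y in nhds w. (F has_derivative blinfun_apply (F' y)) (at y)"
    and F': "F' differentiable (at w)" and p: "first_order_expansion p w a"
  shows "first_order_expansion (\<lambda>l. F (p l)) (F w) (F' w a)"
proof -
  obtain C where "\<forall>\<^sub>F y in nhds w. norm (F y - F w - F' w (y - w)) \<le> C * norm (y - w) ^ 2"
    using second_order_remainder_bound[OF F F'] .
  then have "vanishes_to_order 2 (\<lambda>l. F (p l) - F w - F' w (p l - w))"
    by (rule vanishes_to_order_compose[OF _ first_order_expansion_imp_vanishes[OF p]])
  moreover have "vanishes_to_order 2 (\<lambda>l. F' w (p l - (w + l *\<^sub>R a)))"
    using p unfolding first_order_expansion_def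
    by (rule vanishes_to_order_linear[OF blinfun.bounded_linear_right])
  ultimately have "vanishes_to_order 2
      (\<lambda>l. F (p l) - F w - F' w (p l - w) + F' w (p l - (w + l *\<^sub>R a)))"
    by (rule vanishes_to_order_add)
  then show ?thesis
    by (simp add: first_order_expansion_def blinfun.bilinear_simps algebra_simps)
qed

section \<open>Gradient and Hessian of a three times differentiable loss\<close>

lemma three_times_differentiable_at_gradient:
  fixes f :: "'a::euclidean_space \<Rightarrow> real"
  assumes "three_times_differentiable_at f x"
  obtains H :: "'a \<Rightarrow> 'a \<Rightarrow>\<^sub>L 'a" where
    "\<forall>\<^sub>F y in nhds x. GDERIV f y :> grad f y"
    "\<forall>\<^sub>F y in nhds x. (grad f has_derivative blinfun_apply (H y)) (at y)"
    "H differentiable (at x)"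
    "\<And>u v. H x u \<bullet> v = H x v \<bullet> u"
proof -
  obtain f' :: "'a \<Rightarrow> 'a \<Rightarrow>\<^sub>L real" and f'' :: "'a \<Rightarrow> 'a \<Rightarrow>\<^sub>L 'a \<Rightarrow>\<^sub>L real"
    where f': "\<forall>\<^sub>F y in nhds x. (f has_derivative blinfun_apply (f' y)) (at y)"
      and f'': "\<forall>\<^sub>F y in nhds x. (f' has_derivative blinfun_apply (f'' y)) (at y)"
      and f''': "f'' differentiable (at x)"
    using assms unfolding three_times_differentiable_at_def by blast
  \<comment> \<open>The Riesz map from functionals to vectors. Being bounded and linear, it passes
    through derivatives and turns \<open>f'\<close> into the gradient and \<open>f''\<close> into
    the Hessian operator.\<close>
  define R :: "('a \<Rightarrow>\<^sub>L real) \<Rightarrow>\<^sub>L 'a" where "R = Blinfun (\<lambda>T. \<Sum>b\<in>Basis. blinfun_apply T b *\<^sub>R b)"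
  have R: "R T = (\<Sum>b\<in>Basis. T b *\<^sub>R b)" for T
    unfolding R_def by (subst bounded_linear_Blinfun_apply) (auto intro!: bounded_linear_intros)
  have inner_R: "R T \<bullet> h = T h" for T h
  proof -
    have "T h = T (\<Sum>b\<in>Basis. (h \<bullet> b) *\<^sub>R b)"
      by (simp add: euclidean_representation)
    also have "\<dots> = R T \<bullet> h"
      by (simp add: R blinfun.sum_right blinfun.scaleR_right inner_sum_left inner_commute[of h] mult.commute)
    finally show ?thesis by simp
  qed
  have gderiv: "GDERIV f y :> R (f' y)" if "(f has_derivative blinfun_apply (f' y)) (at y)" for y
    using that by (simp add: gderiv_def inner_commute[of _ "R (f' y)"] inner_R)
  show thesis
  proof (rule that[of "\<lambda>y. R o\<^sub>L f'' y"])
    show "\<forall>\<^sub>F y in nhds x. GDERIV f y :> grad f y"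
      using f' by eventually_elim (use gderiv grad_eqI in metis)
    \<comment> \<open>To differentiate \<open>grad f\<close> at \<open>y\<close>, the identity with
      \<open>R (f' z)\<close> must hold on a neighbourhood of \<open>y\<close>, not just at
      \<open>y\<close>.\<close>
    have "\<forall>\<^sub>F y in nhds x. \<forall>\<^sub>F z in nhds y. grad f z = R (f' z)"
      using f' unfolding eventually_eventually by eventually_elim (use gderiv grad_eqI in metis)
    then show "\<forall>\<^sub>F y in nhds x. (grad f has_derivative blinfun_apply (R o\<^sub>L f'' y)) (at y)"
      using f''
    proof eventually_elim
      case (elim y)
      have "((\<lambda>z. R (f' z)) has_derivative (\<lambda>h. R (f'' y h))) (at y)"
        by (rule bounded_linear.has_derivative[OF blinfun.bounded_linear_right elim(2)])
      then have "(grad f has_derivative (\<lambda>h. R (f'' y h))) (at y)"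
        by (rule has_derivative_transform_eventually)
          (use elim(1) in \<open>auto simp: eventually_at_filter dest: eventually_nhds_x_imp_x elim: eventually_mono\<close>)
      then show ?case
        by (simp add: blinfun_compose.rep_eq o_def)
    qed
    show "(\<lambda>y. R o\<^sub>L f'' y) differentiable (at x)"
      using f''' bounded_linear.has_derivative[OF bounded_bilinear.bounded_linear_right[OF
          bounded_bilinear_blinfun_compose]]
      unfolding differentiable_def by blast
    have "f'' x u v = f'' x v u" for u v
      using f' eventually_nhds_x_imp_x[OF f''] by (rule second_derivative_symmetric)
    then show "(R o\<^sub>L f'' x) u \<bullet> v = (R o\<^sub>L f'' x) v \<bullet> u" for u v
      by (simp add: inner_R)
  qed
qed

section \<open>The inner loop, its Jacobian and the meta-gradient\<close>

text \<open>The first two assumptions hold near \<open>w\<close> because the loop evaluates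
  gradients away from \<open>w\<close>; the last two concern \<open>w\<close> itself, where the
  leading coefficients live.\<close>

locale inner_loop_expansion =
  fixes L :: "'a::euclidean_space \<Rightarrow> 'b \<Rightarrow> real" and B :: "nat \<Rightarrow> 'b" and K :: nat and w :: 'a
    and H :: "nat \<Rightarrow> 'a \<Rightarrow> 'a \<Rightarrow>\<^sub>L 'a"
  assumes GDERIV_loss:
      "k \<le> K \<Longrightarrow> \<forall>\<^sub>F y in nhds w. GDERIV (\<lambda>\<phi>. L \<phi> (B k)) y :> batch_gradient L B k y"
    and has_derivative_batch_gradient:
      "k \<le> K \<Longrightarrow> \<forall>\<^sub>F y in nhds w. (batch_gradient L B k has_derivative blinfun_apply (H k y)) (at y)"
    and differentiable_Hessian: "k \<le> K \<Longrightarrow> H k differentiable (at w)"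
    and Hessian_symmetric: "k \<le> K \<Longrightarrow> H k w u \<bullet> v = H k w v \<bullet> u"
begin

text \<open>The chain rule for one gradient step, that is, the ordered product of the factors
  \<open>I - l H_k(phi_k)\<close>. It is defined for every \<open>l\<close>, but shown to be the
  derivative of the loop only for small \<open>l\<close>.\<close>

primrec jacobian :: "real \<Rightarrow> nat \<Rightarrow> 'a \<Rightarrow>\<^sub>L 'a" where
  "jacobian l 0 = id_blinfun"
| "jacobian l (Suc k) = jacobian l k - l *\<^sub>R (H k (inner_loop L B l w k) o\<^sub>L jacobian l k)"

lemma inner_loop_Suc:
  "inner_loop L B l v (Suc k) = inner_loop L B l v k - l *\<^sub>R batch_gradient L B k (inner_loop L B l v k)"
  by (simp add: batch_gradient_def)

lemma batch_gradient_at: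
  "k \<le> K \<Longrightarrow> (batch_gradient L B k has_derivative blinfun_apply (H k w)) (at w)"
  by (rule eventually_nhds_x_imp_x[OF has_derivative_batch_gradient])

text \<open>The gradient is continuous at \<open>w\<close>, so it converges along the iterates and
  the step, scaled by \<open>l\<close>, tends to 0. The limit is joint in \<open>l\<close> and the
  start because gradients must exist along loops started near \<open>w\<close> as well.\<close>

lemma inner_loop_tendsto:
  "k \<le> K \<Longrightarrow> ((\<lambda>(l, v). inner_loop L B l v k) \<longlongrightarrow> w) (at_right 0 \<times>\<^sub>F nhds w)"
proof (induction k)
  case 0
  show ?case
    by (simp add: case_prod_beta' filterlim_snd)
next
  case (Suc k)
  let ?p = "\<lambda>x. inner_loop L B (fst x) (snd x) k"
  have p: "(?p \<longlongrightarrow> w) (at_right 0 \<times>\<^sub>F nhds w)"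
    using Suc by (simp add: case_prod_beta')
  have "isCont (batch_gradient L B k) w"
    using batch_gradient_at[of k] Suc.prems by (auto intro: has_derivative_continuous)
  then have g: "((\<lambda>x. batch_gradient L B k (?p x)) \<longlongrightarrow> batch_gradient L B k w) (at_right 0 \<times>\<^sub>F nhds w)"
    using p by (rule isCont_tendsto_compose)
  have "filterlim fst (at_right (0::real)) (at_right 0 \<times>\<^sub>F nhds w)"
    by (rule filterlim_fst)
  then have l: "(fst \<longlongrightarrow> (0::real)) (at_right 0 \<times>\<^sub>F nhds w)"
    by (rule filterlim_mono[OF _ _ order_refl]) (simp add: at_within_le_nhds)
  have "((\<lambda>x. ?p x - fst x *\<^sub>R batch_gradient L B k (?p x)) \<longlongrightarrow> w - 0 *\<^sub>R batch_gradient L B k w)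
      (at_right 0 \<times>\<^sub>F nhds w)"
    by (intro tendsto_diff tendsto_scaleR p g l)
  then show ?case
    unfolding inner_loop_Suc by (simp add: case_prod_beta')
qed

lemma eventually_inner_loop:
  assumes "k \<le> K" and "\<forall>\<^sub>F y in nhds w. P y"
  shows "\<forall>\<^sub>F l in at_right 0. \<forall>\<^sub>F v in nhds w. P (inner_loop L B l v k)"
proof -
  have "\<forall>\<^sub>F x in at_right 0 \<times>\<^sub>F nhds w. P (case x of (l, v) \<Rightarrow> inner_loop L B l v k)"
    by (rule eventually_compose_filterlim[OF assms(2) inner_loop_tendsto[OF assms(1)]])
  then obtain Q R where QR: "eventually Q (at_right 0)" "eventually R (nhds w)"
    "\<And>l v. Q l \<Longrightarrow> R v \<Longrightarrow> P (inner_loop L B l v k)"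
    unfolding eventually_prod_filter by auto
  from QR(1) show ?thesis
    by eventually_elim (use QR(2,3) in \<open>auto elim: eventually_mono\<close>)
qed

lemma eventually_inner_loop_at:
  assumes "k \<le> K" and "\<forall>\<^sub>F y in nhds w. P y"
  shows "\<forall>\<^sub>F l in at_right 0. P (inner_loop L B l w k)"
  using eventually_inner_loop[OF assms] by eventually_elim (rule eventually_nhds_x_imp_x)

lemma inner_loop_has_derivative:
  "k \<le> K \<Longrightarrow> \<forall>\<^sub>F l in at_right 0.
    ((\<lambda>v. inner_loop L B l v k) has_derivative blinfun_apply (jacobian l k)) (at w)"
proof (induction k)
  case 0
  show ?case by (simp add: has_derivative_ident)
next
  case (Suc k)
  then have k: "k \<le> K" by simp
  from Suc.IH[OF k] eventually_inner_loop_at[OF k has_derivative_batch_gradient[OF k]]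
  show ?case
  proof eventually_elim
    case (elim l)
    have "((\<lambda>v. inner_loop L B l v k - l *\<^sub>R batch_gradient L B k (inner_loop L B l v k)) has_derivative
        (\<lambda>h. jacobian l k h - l *\<^sub>R H k (inner_loop L B l w k) (jacobian l k h))) (at w)"
      by (intro has_derivative_diff has_derivative_scaleR_right elim(1)
          has_derivative_compose[OF elim(1) elim(2)])
    then show ?case
      unfolding inner_loop_Suc
      by (rule has_derivative_eq_rhs) (simp add: fun_eq_iff blinfun.bilinear_simps)
  qed
qed

lemma inner_loop_first_order:
  "k \<le> K \<Longrightarrow> first_order_expansion (\<lambda>l. inner_loop L B l w k) w (- (\<Sum>j<k. batch_gradient L B j w))"
proof (induction k)
  case 0
  show ?case by (simp add: first_order_expansion_const)
next
  case (Suc k)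
  then have k: "k \<le> K" by simp
  have "batch_gradient L B k differentiable (at w)"
    using batch_gradient_at[OF k] by (auto simp: differentiable_def)
  then have "vanishes_to_order 1 (\<lambda>l. batch_gradient L B k (inner_loop L B l w k) - batch_gradient L B k w)"
    using first_order_expansion_imp_vanishes[OF Suc.IH[OF k]]
    by (rule vanishes_to_order_compose_differentiable)
  from first_order_expansion_diff[OF Suc.IH[OF k] first_order_expansion_scaleR[OF this]]
  show ?case
    by (simp only: inner_loop_Suc sum.lessThan_Suc minus_add_distrib add_uminus_conv_diff diff_zero)
qed

lemma jacobian_first_order:
  "k \<le> K \<Longrightarrow> first_order_expansion (\<lambda>l. jacobian l k) id_blinfun (- (\<Sum>j<k. H j w))"
proof (induction k)
  case 0
  show ?case by (simp add: first_order_expansion_const)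
next
  case (Suc k)
  then have k: "k \<le> K" by simp
  have "vanishes_to_order 1 (\<lambda>l. H k (inner_loop L B l w k) - H k w)"
    using differentiable_Hessian[OF k] first_order_expansion_imp_vanishes[OF inner_loop_first_order[OF k]]
    by (rule vanishes_to_order_compose_differentiable)
  from vanishes_to_order_bilinear_limit[OF bounded_bilinear_blinfun_compose this
      first_order_expansion_imp_vanishes[OF Suc.IH[OF k]]]
  have "vanishes_to_order 1 (\<lambda>l. (H k (inner_loop L B l w k) o\<^sub>L jacobian l k) - H k w)"
    by (simp add: blinfun_compose_id_right)
  from first_order_expansion_diff[OF Suc.IH[OF k] first_order_expansion_scaleR[OF this]]
  show ?case
    by (simp only: jacobian.simps sum.lessThan_Suc minus_add_distrib add_uminus_conv_diff diff_zero)
qed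

text \<open>Kept as a functional of \<open>h\<close>, the derivative involves no adjoint of the
  Jacobian.\<close>

lemma meta_loss_has_derivative:
  "\<forall>\<^sub>F l in at_right 0. (meta_loss L B K l has_derivative
    (\<lambda>h. jacobian l K h \<bullet> batch_gradient L B K (inner_loop L B l w K))) (at w)"
  using inner_loop_has_derivative[OF order_refl] eventually_inner_loop_at[OF order_refl GDERIV_loss[OF order_refl]]
proof eventually_elim
  case (elim l)
  then show ?case
    unfolding meta_loss_def gderiv_def by (rule has_derivative_compose)
qed

lemma has_derivative_inner_batch_gradients:
  assumes "k \<le> K"
  shows "((\<lambda>\<phi>. batch_gradient L B K \<phi> \<bullet> batch_gradient L B k \<phi>) has_derivative
    (\<lambda>h. batch_gradient L B K w \<bullet> H k w h + H K w h \<bullet> batch_gradient L B k w)) (at w)"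
  by (intro has_derivative_inner batch_gradient_at assms order_refl)

lemma inner_gradient_alignment:
  "h \<bullet> gradient_alignment L B K w =
    (\<Sum>k<K. batch_gradient L B K w \<bullet> H k w h + H K w h \<bullet> batch_gradient L B k w)"
  unfolding gradient_alignment_def inner_sum_right
proof (rule sum.cong)
  fix k assume "k \<in> {..<K}"
  then have D: "((\<lambda>\<phi>. batch_gradient L B K \<phi> \<bullet> batch_gradient L B k \<phi>) has_derivative
      (\<lambda>h. batch_gradient L B K w \<bullet> H k w h + H K w h \<bullet> batch_gradient L B k w)) (at w)"
    by (intro has_derivative_inner_batch_gradients) simp
  then have "GDERIV (\<lambda>\<phi>. batch_gradient L B K \<phi> \<bullet> batch_gradient L B k \<phi>) w
      :> grad (\<lambda>\<phi>. batch_gradient L B K \<phi> \<bullet> batch_gradient L B k \<phi>) w"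
    by (intro GDERIV_grad) (auto simp: differentiable_def)
  from fun_cong[OF has_derivative_unique[OF this[unfolded gderiv_def] D]]
  show "h \<bullet> grad (\<lambda>\<phi>. batch_gradient L B K \<phi> \<bullet> batch_gradient L B k \<phi>) w =
      batch_gradient L B K w \<bullet> H k w h + H K w h \<bullet> batch_gradient L B k w" .
qed simp

lemma meta_gradient_first_order:
  "first_order_expansion (\<lambda>l. meta_gradient L B K l w) (batch_gradient L B K w) (- gradient_alignment L B K w)"
proof -
  \<comment> \<open>The derivative of the meta-loss as an operator. It is bilinear in the final
    gradient and the Jacobian, so the product rule for expansions applies to it directly.\<close>
  let ?T = "\<lambda>l. blinfun_inner_left (batch_gradient L B K (inner_loop L B l w K)) o\<^sub>L jacobian l K"
  let ?g = "batch_gradient L B K w" and ?A = "gradient_alignment L B K w"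
  have "first_order_expansion (\<lambda>l. batch_gradient L B K (inner_loop L B l w K))
      ?g (H K w (- (\<Sum>j<K. batch_gradient L B j w)))"
    by (intro first_order_expansion_compose has_derivative_batch_gradient differentiable_Hessian
        inner_loop_first_order order_refl)
  from first_order_expansion_bilinear[OF
      bounded_bilinear.comp1[OF bounded_bilinear_blinfun_compose bounded_linear_blinfun_inner_left]
      this jacobian_first_order[OF order_refl]]
  have "first_order_expansion ?T (blinfun_inner_left ?g o\<^sub>L id_blinfun)
      ((blinfun_inner_left ?g o\<^sub>L - (\<Sum>j<K. H j w)) +
       (blinfun_inner_left (H K w (- (\<Sum>j<K. batch_gradient L B j w))) o\<^sub>L id_blinfun))" .
  moreover have "(blinfun_inner_left ?g o\<^sub>L - (\<Sum>j<K. H j w)) +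
       (blinfun_inner_left (H K w (- (\<Sum>j<K. batch_gradient L B j w))) o\<^sub>L id_blinfun)
      = blinfun_inner_left (- ?A)"
  proof (rule blinfun_eqI)
    fix h
    \<comment> \<open>Symmetry enters here: \<open>H K w\<close> moves from \<open>h\<close> onto
      the summed gradients. The terms with \<open>H j w\<close> already match as pairings with
      \<open>h\<close>.\<close>
    have "(\<Sum>j<K. H K w h \<bullet> batch_gradient L B j w) = h \<bullet> H K w (\<Sum>j<K. batch_gradient L B j w)"
      using Hessian_symmetric[of K h "\<Sum>j<K. batch_gradient L B j w"]
      by (simp add: inner_sum_right[symmetric] inner_commute)
    then show "blinfun_apply ((blinfun_inner_left ?g o\<^sub>L - (\<Sum>j<K. H j w)) +
       (blinfun_inner_left (H K w (- (\<Sum>j<K. batch_gradient L B j w))) o\<^sub>L id_blinfun)) h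
      = blinfun_apply (blinfun_inner_left (- ?A)) h"
      by (simp add: inner_gradient_alignment blinfun.bilinear_simps blinfun.sum_left
          inner_sum_left inner_sum_right sum.distrib inner_commute)
  qed
  moreover have "blinfun_inner_left ?g + l *\<^sub>R blinfun_inner_left (- ?A)
      = blinfun_inner_left (?g - l *\<^sub>R ?A)" for l
    by (rule blinfun_eqI) (simp add: blinfun.bilinear_simps inner_diff_right)
  ultimately have T: "vanishes_to_order 2 (\<lambda>l. ?T l - blinfun_inner_left (?g - l *\<^sub>R ?A))"
    by (simp only: first_order_expansion_def blinfun_compose_id_right)
  have "\<forall>\<^sub>F l in at_right 0. norm (meta_gradient L B K l w - (?g - l *\<^sub>R ?A))
      \<le> 1 * norm (?T l - blinfun_inner_left (?g - l *\<^sub>R ?A))"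
    using meta_loss_has_derivative
  proof eventually_elim
    case (elim l)
    define d where "d = meta_gradient L B K l w - (?g - l *\<^sub>R ?A)"
    have "GDERIV (meta_loss L B K l) w :> meta_gradient L B K l w"
      unfolding meta_gradient_def using elim by (intro GDERIV_grad) (auto simp: differentiable_def)
    from fun_cong[OF has_derivative_unique[OF this[unfolded gderiv_def] elim]]
    have "?T l - blinfun_inner_left (?g - l *\<^sub>R ?A) = blinfun_inner_left d"
      by (intro blinfun_eqI) (simp add: d_def blinfun.diff_left inner_diff_right)
    \<comment> \<open>Evaluating the functional at \<open>d\<close> itself bounds the error vector
      by the operator norm, so the operator expansion passes to gradients.\<close>
    moreover have "norm d * norm d \<le> norm (blinfun_inner_left d) * norm d"
      using norm_blinfun[of "blinfun_inner_left d" d]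
      by (simp add: dot_square_norm power2_eq_square)
    ultimately show ?case
      unfolding d_def[symmetric] by (cases "d = 0") auto
  qed
  from vanishes_to_orderI[OF this T] show ?thesis
    by (simp add: first_order_expansion_def)
qed

end

theorem proposition1:
  fixes L :: "real ^ 'd \<Rightarrow> 'b \<Rightarrow> real" and B :: "nat \<Rightarrow> 'b" and K :: nat and w :: "real ^ 'd"
  assumes "K \<ge> 1"
    and "\<And>k. k \<le> K \<Longrightarrow> three_times_differentiable_at (\<lambda>\<phi>. L \<phi> (B k)) w"
  \<comment> \<open>The first three conjuncts say that the gradients involved exist, so that the last one
    does not refer to unspecified values of \<open>grad\<close>.\<close>
  shows
    "(\<forall>\<^sub>F l in at_right 0. \<forall>\<^sub>F v in nhds w. \<forall>k<K.
        (\<lambda>\<phi>. L \<phi> (B k)) differentiable at (inner_loop L B l v k)) \<and>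
     (\<forall>\<^sub>F l in at_right 0. meta_loss L B K l differentiable at w) \<and>
     (\<forall>k<K. (\<lambda>\<phi>. batch_gradient L B K \<phi> \<bullet> batch_gradient L B k \<phi>) differentiable at w) \<and>
     (\<lambda>l. norm (meta_gradient L B K l w -
         (batch_gradient L B K w - l *\<^sub>R gradient_alignment L B K w)))
       \<in> O[at_right 0](\<lambda>l. l ^ 2)"
proof -
  define good where "good k H \<longleftrightarrow>
      (\<forall>\<^sub>F y in nhds w. GDERIV (\<lambda>\<phi>. L \<phi> (B k)) y :> batch_gradient L B k y) \<and>
      (\<forall>\<^sub>F y in nhds w. (batch_gradient L B k has_derivative blinfun_apply (H y)) (at y)) \<and>
      H differentiable (at w) \<and> (\<forall>u v. H w u \<bullet> v = H w v \<bullet> u)"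
    for k and H :: "real ^ 'd \<Rightarrow> (real ^ 'd) \<Rightarrow>\<^sub>L (real ^ 'd)"
  \<comment> \<open>The implication lets choice run over all \<open>k\<close>; beyond
    \<open>K\<close> the chosen Hessian is arbitrary.\<close>
  have "\<exists>H. k \<le> K \<longrightarrow> good k H" for k
  proof (cases "k \<le> K")
    case True
    have bg: "batch_gradient L B k = grad (\<lambda>\<phi>. L \<phi> (B k))"
      by (simp add: fun_eq_iff batch_gradient_def)
    show ?thesis
    proof (rule three_times_differentiable_at_gradient[OF assms(2)[OF True]], intro exI impI)
      fix H :: "real ^ 'd \<Rightarrow> (real ^ 'd) \<Rightarrow>\<^sub>L (real ^ 'd)"
      assume "\<forall>\<^sub>F y in nhds w. GDERIV (\<lambda>\<phi>. L \<phi> (B k)) y :> grad (\<lambda>\<phi>. L \<phi> (B k)) y"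
        "\<forall>\<^sub>F y in nhds w. (grad (\<lambda>\<phi>. L \<phi> (B k)) has_derivative blinfun_apply (H y)) (at y)"
        "H differentiable (at w)" "\<And>u v. H w u \<bullet> v = H w v \<bullet> u"
      then show "good k H"
        unfolding good_def bg by (intro conjI allI)
    qed
  qed simp
  then obtain H where "\<forall>k. k \<le> K \<longrightarrow> good k (H k)"
    using choice[of "\<lambda>k H. k \<le> K \<longrightarrow> good k H"] by blast
  then have "inner_loop_expansion L B K w H"
    by unfold_locales (simp_all add: good_def)
  then interpret inner_loop_expansion L B K w H .
  have "\<forall>\<^sub>F l in at_right 0. \<forall>\<^sub>F v in nhds w. (\<lambda>\<phi>. L \<phi> (B k)) differentiable at (inner_loop L B l v k)"
    if "k < K" for k
  proof (rule eventually_inner_loop)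
    show "\<forall>\<^sub>F y in nhds w. (\<lambda>\<phi>. L \<phi> (B k)) differentiable at y"
      using GDERIV_loss[of k] that unfolding gderiv_def
      by (auto simp: differentiable_def elim!: eventually_mono)
  qed (use that in simp)
  \<comment> \<open>The quantifier over \<open>k\<close> moves inside both filters because there are
    finitely many steps.\<close>
  then have "\<forall>\<^sub>F l in at_right 0. \<forall>k\<in>{..<K}. \<forall>\<^sub>F v in nhds w.
      (\<lambda>\<phi>. L \<phi> (B k)) differentiable at (inner_loop L B l v k)"
    by (intro eventually_ball_finite) auto
  then have "\<forall>\<^sub>F l in at_right 0. \<forall>\<^sub>F v in nhds w. \<forall>k\<in>{..<K}.
      (\<lambda>\<phi>. L \<phi> (B k)) differentiable at (inner_loop L B l v k)"
    by eventually_elim (auto intro: eventually_ball_finite)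
  moreover have "\<forall>\<^sub>F l in at_right 0. meta_loss L B K l differentiable at w"
    using meta_loss_has_derivative by eventually_elim (auto simp: differentiable_def)
  moreover have "\<forall>k<K. (\<lambda>\<phi>. batch_gradient L B K \<phi> \<bullet> batch_gradient L B k \<phi>) differentiable at w"
    unfolding differentiable_def using has_derivative_inner_batch_gradients less_imp_le by blast
  moreover have "(\<lambda>l. norm (meta_gradient L B K l w -
         (batch_gradient L B K w - l *\<^sub>R gradient_alignment L B K w)))
       \<in> O[at_right 0](\<lambda>l. l ^ 2)"
    using meta_gradient_first_order
    by (simp add: first_order_expansion_def vanishes_to_order_def)
  ultimately show ?thesis
    by (simp add: Ball_def)
qed

end
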